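(* Fix an integer $n\geq 2$. Then $\varepsilon_2(n,l)=\mathcal{O}\!\left(n^{3l/4}\right)$ as $l\to\infty$.
   Context: A nonempty word $u$ is primitive if $u=v^m$ with $m$ a positive integer implies $m=1$; $|u|$ is its length. For an alphabet $\mathcal{A}$ of size $n$, $\varepsilon_2(n,l)$ is the number of pairs $(p,q)$ of primitive words over $\mathcal{A}$ with $|p|=2|q|=2l$, $pq$ not primitive, for which there exist nonempty words $\alpha,\beta$ and an integer $s\geq1$ with $\alpha\beta$ primitive, $q=(\alpha\beta)^{s}\alpha$, and either ($p=(\beta\alpha)^{2s}\beta$ and $|\beta|=2|\alpha|$) or ($p=(\beta\alpha)^{2s+1}\beta$ and $|\alpha|=2|\beta|$). *)

theory Defs
  imports Complex_Main "HOL-Library.Landau_Symbols"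
begin

(* The library's overloaded iteration operator has no instance for lists. *)
definition wpow :: "'a list \<Rightarrow> nat \<Rightarrow> 'a list" (infixr "^\<^sub>w" 80) where
  "v ^\<^sub>w m = concat (replicate m v)"

definition primitive :: "'a list \<Rightarrow> bool" where
  "primitive u \<longleftrightarrow> u \<noteq> [] \<and> (\<forall>v m. m \<ge> 1 \<longrightarrow> u = v ^\<^sub>w m \<longrightarrow> m = 1)"

definition eps2_pairs :: "'a set \<Rightarrow> nat \<Rightarrow> ('a list \<times> 'a list) set" where
  "eps2_pairs A l = {(p, q).
     p \<in> lists A \<and> q \<in> lists A \<and> primitive p \<and> primitive q \<and>
     length p = 2 * length q \<and> length q = l \<and> \<not> primitive (p @ q) \<and>
     (\<exists>\<alpha>\<in>lists A. \<exists>\<beta>\<in>lists A. \<exists>s\<ge>1. \<alpha> \<noteq> [] \<and> \<beta> \<noteq> [] \<and> primitive (\<alpha> @ \<beta>) \<and>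
        q = (\<alpha> @ \<beta>) ^\<^sub>w s @ \<alpha> \<and>
        (p = (\<beta> @ \<alpha>) ^\<^sub>w (2 * s) @ \<beta> \<and> length \<beta> = 2 * length \<alpha> \<or>
         p = (\<beta> @ \<alpha>) ^\<^sub>w (2 * s + 1) @ \<beta> \<and> length \<alpha> = 2 * length \<beta>))}"

(* Parametrised by the alphabet itself; the count depends only on its size n.
   For finite A the set counted is finite, so card has its intended meaning. *)
definition eps2 :: "'a set \<Rightarrow> nat \<Rightarrow> nat" where
  "eps2 A l = card (eps2_pairs A l)"

lemma finite_eps2_pairs:
  assumes "finite A"
  shows "finite (eps2_pairs A l)"
proof (rule finite_subset)
  show "eps2_pairs A l \<subseteq>
      {p. set p \<subseteq> A \<and> length p = 2 * l} \<times> {q. set q \<subseteq> A \<and> length q = l}"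
    by (auto simp: eps2_pairs_def)
qed (intro finite_cartesian_product finite_lists_length_eq assms)

end

(* A pair is determined by the word w = \<alpha>\<beta> together with the ratio of the lengths of
   \<alpha> and \<beta>: if |w| = 3k, then l = (3s+1)k or l = (3s+2)k, so l and k give s, and
   s \<ge> 1 forces |w| \<le> 3l/4.  There are at most 2 n^m words of length at most m. *)
theory Submission
  imports Defs
begin

lemma length_wpow [simp]: "length (v ^\<^sub>w m) = m * length v"
  by (induction m) (simp_all add: wpow_def)

text \<open>For \<open>n \<ge> 2\<close> the bound \<open>2 * n ^ m\<close> on the earlier terms is
  absorbed by the next power, so the factor 2 survives the induction.\<close>

lemma sum_power_le_twice_last:
  fixes n :: nat
  assumes "n \<ge> 2"
  shows "(\<Sum>i\<le>m. n ^ i) \<le> 2 * n ^ m"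
proof (induction m)
  case (Suc m)
  have "2 * n ^ m \<le> n ^ Suc m"
    using assms by simp
  with Suc show ?case
    by (simp del: power_Suc)
qed simp

text \<open>Decodes a pair from \<open>w\<close> and the length \<open>j\<close> of \<alpha> in
  units of \<open>k\<close>. The exponent \<open>2 * s + j - 1\<close> merges both forms of
  \<open>p\<close>: \<open>2 * s\<close> for \<open>j = 1\<close>, \<open>2 * s + 1\<close> for
  \<open>j = 2\<close>. Values at words not of the form \<alpha>\<beta> are harmless, since the
  image only has to cover all pairs.\<close>

definition eps2_pair :: "nat \<Rightarrow> nat \<times> 'a list \<Rightarrow> 'a list \<times> 'a list" where
  "eps2_pair l = (\<lambda>(j, w).
     let k = length w div 3; s = l div k div 3; \<alpha> = take (j * k) w; \<beta> = drop (j * k) w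
     in ((\<beta> @ \<alpha>) ^\<^sub>w (2 * s + j - 1) @ \<beta>, (\<alpha> @ \<beta>) ^\<^sub>w s @ \<alpha>))"

lemma eps2_pairs_subset_image:
  "eps2_pairs A l \<subseteq>
     eps2_pair l ` ({1, 2} \<times> {w. set w \<subseteq> A \<and> length w \<le> 3 * l div 4})"
proof
  fix x assume "x \<in> eps2_pairs A l"
  then obtain p q where x: "x = (p, q)" and pq: "(p, q) \<in> eps2_pairs A l"
    by (cases x) simp
  from pq obtain \<alpha> \<beta> s where l: "length q = l"
    and "\<alpha> \<in> lists A" "\<beta> \<in> lists A" and s: "s \<ge> 1" and ne: "\<alpha> \<noteq> []" "\<beta> \<noteq> []"
    and q: "q = (\<alpha> @ \<beta>) ^\<^sub>w s @ \<alpha>"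
    and p: "p = (\<beta> @ \<alpha>) ^\<^sub>w (2 * s) @ \<beta> \<and> length \<beta> = 2 * length \<alpha> \<or>
            p = (\<beta> @ \<alpha>) ^\<^sub>w (2 * s + 1) @ \<beta> \<and> length \<alpha> = 2 * length \<beta>"
    unfolding eps2_pairs_def mem_Collect_eq case_prod_conv by blast
  have AB: "set (\<alpha> @ \<beta>) \<subseteq> A"
    using \<open>\<alpha> \<in> lists A\<close> \<open>\<beta> \<in> lists A\<close> by auto
  \<comment> \<open>Here \<open>k\<close> is the length of the shorter of \<alpha> and
    \<beta>.\<close>
  obtain j k where j: "j \<in> {1, 2}" and p': "p = (\<beta> @ \<alpha>) ^\<^sub>w (2 * s + j - 1) @ \<beta>"
    and \<alpha>: "length \<alpha> = j * k" and w: "length (\<alpha> @ \<beta>) = 3 * k"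
  proof (cases "length \<beta> = 2 * length \<alpha>")
    case True
    \<comment> \<open>The second form of \<open>p\<close> would give \<alpha> four times its own
      length, impossible for a nonempty word.\<close>
    with p ne show thesis by (intro that[of 1 "length \<alpha>"]) auto
  next
    case False
    with p show thesis by (intro that[of 2 "length \<beta>"]) auto
  qed
  have k: "k > 0"
    using w ne by (cases k) auto
  have l': "l = (3 * s + j) * k"
  proof -
    have "l = s * length (\<alpha> @ \<beta>) + length \<alpha>"
      using l q by simp
    thus ?thesis
      unfolding w \<alpha> by (simp add: algebra_simps)
  qed
  \<comment> \<open>Source of the exponent 3/4: \<open>3 * s + j\<close> is smallest at
    \<open>s = j = 1\<close>, where it is 4.\<close>
  have "4 * k \<le> l"
    unfolding l' using s j by (intro mult_right_mono) auto
  hence len: "length (\<alpha> @ \<beta>) \<le> 3 * l div 4"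
    unfolding w by linarith
  \<comment> \<open>\<open>l div k\<close> is \<open>3 * s + j\<close>, and \<open>j < 3\<close> is
    the remainder modulo 3.\<close>
  have "l div k div 3 = s"
    using k j by (auto simp: l')
  moreover have "length (\<alpha> @ \<beta>) div 3 = k"
    using w by simp
  moreover have "take (j * k) (\<alpha> @ \<beta>) = \<alpha>" "drop (j * k) (\<alpha> @ \<beta>) = \<beta>"
    using \<alpha> by simp_all
  ultimately have "eps2_pair l (j, \<alpha> @ \<beta>) = x"
    unfolding eps2_pair_def Let_def x p' q case_prod_conv by (simp only:)
  with j AB len show "x \<in> eps2_pair l ` ({1, 2} \<times> {w. set w \<subseteq> A \<and> length w \<le> 3 * l div 4})"
    by blast
qed

text \<open>The constant 4 is 2 for the choices of \<open>j\<close> times 2 from the geometric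
  sum.\<close>

lemma eps2_le:
  assumes "finite A" and "card A \<ge> 2"
  shows "eps2 A l \<le> 4 * card A ^ (3 * l div 4)"
proof -
  let ?W = "{w. set w \<subseteq> A \<and> length w \<le> 3 * l div 4}"
  have fin: "finite ?W"
    using assms(1) by (rule finite_lists_length_le)
  have "eps2 A l \<le> card (eps2_pair l ` ({1, 2} \<times> ?W))"
    unfolding eps2_def using fin by (intro card_mono eps2_pairs_subset_image) auto
  also have "\<dots> \<le> card ({1, 2 :: nat} \<times> ?W)"
    using fin by (intro card_image_le) auto
  also have "\<dots> = 2 * (\<Sum>i\<le>3 * l div 4. card A ^ i)"
    using assms(1) by (simp add: card_cartesian_product card_lists_length_le)
  also have "\<dots> \<le> 4 * card A ^ (3 * l div 4)"
    using sum_power_le_twice_last[OF assms(2), of "3 * l div 4"] by simp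
  finally show ?thesis .
qed

theorem theorem4p3:
  fixes A :: "'a set" and n :: nat
  assumes "n \<ge> 2" and "finite A" and "card A = n"
  shows "(\<lambda>l. real (eps2 A l)) \<in> O[at_top](\<lambda>l. real n powr (3 * real l / 4))"
proof (rule bigoI[where c = 4], intro always_eventually allI)
  fix l
  have "real (eps2 A l) \<le> real (4 * n ^ (3 * l div 4))"
    using eps2_le[of A l] assms by (intro of_nat_mono) simp
  also have "\<dots> = 4 * real n powr real (3 * l div 4)"
    using assms(1) by (simp add: powr_realpow)
  \<comment> \<open>Integer division rounds down, and \<open>powr\<close> is monotone in the
    exponent for bases at least 1.\<close>
  also have "\<dots> \<le> 4 * real n powr (3 * real l / 4)"
    using assms(1) by (intro mult_left_mono powr_mono) linarith+
  finally show "norm (real (eps2 A l)) \<le> 4 * norm (real n powr (3 * real l / 4))"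
    by simp
qed

end
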